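(* For $n\ge 1$ and $0\le p\le n-1$, let $G_{n,p}$ be the number of configurations of size $n$ in which exactly $p$ of the other $n-1$ pairs contain the given pair. Then $$\sum_{n\ge1}\sum_{p=0}^{n-1} G_{n,p}\,y^p\,\frac{z^n}{n!}=\frac{1}{(1-y)\sqrt{1-2z}}\ln\left(\frac{1-z(1+y)}{1-2z}\right).$$
   Context: Fix $n\ge1$. A configuration (of size $n$) is a perfect matching of the $2n$ points $1,2,\dots,2n$ (laid out on a line) into $n$ unordered pairs, together with one distinguished pair, called the given pair; the other $n-1$ pairs are treated as indistinguishable, so there are $n\,(2n-1)!!$ configurations. Let the given pair be $\{g<h\}$ and let $\{a<b\}$ be another pair. The pair $\{a,b\}$ contains the given pair if $a<g<h<b$. *)

theory Defs
  imports "HOL-Computational_Algebra.Computational_Algebra" "HOL-Library.Disjoint_Sets"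
begin

definition perfect_matchings :: "nat \<Rightarrow> nat set set set" where
  "perfect_matchings n = {M. partition_on {1..2 * n} M \<and> (\<forall>e\<in>M. card e = 2)}"

definition configurations :: "nat \<Rightarrow> (nat set set \<times> nat set) set" where
  "configurations n = {(M, e). M \<in> perfect_matchings n \<and> e \<in> M}"

definition pair_contains :: "nat set \<Rightarrow> nat set \<Rightarrow> bool" where
  "pair_contains f e \<longleftrightarrow> (\<exists>a b g h. f = {a, b} \<and> e = {g, h} \<and> a < g \<and> g < h \<and> h < b)"

definition G :: "nat \<Rightarrow> nat \<Rightarrow> nat" where
  "G n p = card {(M, e) \<in> configurations n. card {f \<in> M - {e}. pair_contains f e} = p}"

text \<open>
  The generating function lives in the ring of formal power series in \<open>z\<close> over the field
  of rational functions in \<open>y\<close> with rational coefficients.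
\<close>

abbreviation yvar :: "rat poly fract" where
  "yvar \<equiv> to_fract [:0, 1:]"

abbreviation zvar :: "rat poly fract fps" where
  "zvar \<equiv> fps_X"

text \<open>
  Both operations below are meant for series with constant coefficient 1. The first
  argument of \<^const>\<open>fps_radical\<close> selects the root of the constant coefficient, here 1;
  \<^term>\<open>fps_ln 1\<close> is the expansion of \<open>ln (1 + x)\<close>.
\<close>

definition fps_sqrt :: "'a::field_char_0 fps \<Rightarrow> 'a fps" where
  "fps_sqrt F = fps_radical (\<lambda>_ _. 1) 2 F"

definition fps_log :: "'a::field_char_0 fps \<Rightarrow> 'a fps" where
  "fps_log F = fps_ln 1 oo (F - 1)"

lemma fps_sqrt_nth_0: "fps_sqrt F $ 0 = 1"
  by (simp add: fps_sqrt_def)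

lemma fps_sqrt_power2:
  assumes "F $ 0 = 1"
  shows "fps_sqrt F ^ 2 = F"
  using power_radical[of F "\<lambda>_ _. 1" 1] assms
  by (simp add: fps_sqrt_def numeral_2_eq_2)

lemma fps_exp_fps_log:
  assumes "F $ 0 = 1"
  shows "fps_exp 1 oo fps_log F = F"
proof -
  have inv: "fps_ln (1::'a) = fps_inv (fps_exp 1 - 1)"
    by (rule fps_ln_fps_exp_inv) simp
  have E: "(fps_exp 1 - 1) oo fps_ln (1::'a) = fps_X"
    unfolding inv by (rule fps_inv_right) auto
  have "(fps_exp 1 - 1) oo fps_log F = ((fps_exp 1 - 1) oo fps_ln 1) oo (F - 1)"
    unfolding fps_log_def using assms
    by (intro fps_compose_assoc) (auto simp: fps_ln_def)
  also have "\<dots> = F - 1" unfolding E using assms by simp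
  finally show ?thesis by (simp add: fps_compose_sub_distrib)
qed

end

theory Submission
  imports Defs
begin

text \<open>
  Deleting the given pair leaves \<open>i\<close> points to its left, \<open>k\<close> inside and \<open>j\<close> to its right, and the
  weight \<open>y\<close> is carried by the edges joining a left point to a right point. The weighted count of
  matchings depends only on \<open>(i, k, j)\<close>, and removing one point gives recursions for it. Removing an
  inside point and summing over \<open>i + k + j = 2n\<close> yields \<open>G\<^sub>n\<^sub>+\<^sub>1 = (2n + 1) G\<^sub>n + H\<^sub>n\<close>, where
  \<open>H\<^sub>n\<close> collects the terms with \<open>k = 0\<close> (given pair adjacent). Removing a left point, together with the symmetry
  \<open>i \<leftrightarrow> j\<close>, yields \<open>H\<^sub>n = n (1 + y) H\<^sub>n\<^sub>-\<^sub>1 + (2n - 1)!!\<close>. So the exponential generating function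
  \<open>F\<close> solves \<open>(1 - 2z) F' = F + Q\<close> with \<open>(1 - (1 + y) z) Q = (1 - 2z)\<^sup>-\<^sup>1\<^sup>/\<^sup>2\<close>; the closed form
  solves the same equation with the same constant term.
\<close>

section \<open>Matchings of a finite set, and summation over them\<close>

text \<open>Any ground set is allowed, since deleting points of \<open>{1..2 * n}\<close> leaves
  sets of no special form.\<close>

definition matchings_on :: "'a set \<Rightarrow> 'a set set set" where
  "matchings_on S = {M. partition_on S M \<and> (\<forall>e\<in>M. card e = 2)}"

text \<open>With \<open>L\<close> and \<open>R\<close> the points before \<open>g\<close> and after
  \<open>h\<close>, this expresses containment of the pair \<open>{g, h}\<close> without mentioning
  it, so the condition still makes sense once that pair is deleted.\<close>

definition straddling :: "'a set \<Rightarrow> 'a set \<Rightarrow> 'a set \<Rightarrow> bool" where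
  "straddling L R e \<longleftrightarrow> e \<inter> L \<noteq> {} \<and> e \<inter> R \<noteq> {}"

text \<open>\<open>L\<close> and \<open>R\<close> need not lie in \<open>S\<close>; they stay fixed
  while points are removed from \<open>S\<close>.\<close>

definition straddle_sum :: "'b::comm_semiring_1 \<Rightarrow> 'a set \<Rightarrow> 'a set \<Rightarrow> 'a set \<Rightarrow> 'b" where
  "straddle_sum y S L R = (\<Sum>M\<in>matchings_on S. y ^ card {f\<in>M. straddling L R f})"

lemma finite_matchings_on: "finite S \<Longrightarrow> finite (matchings_on S)"
  by (rule finite_subset[of _ "Pow (Pow S)"]) (auto simp: matchings_on_def partition_on_def)

lemma finite_matching: "finite S \<Longrightarrow> M \<in> matchings_on S \<Longrightarrow> finite M"
  by (auto simp: matchings_on_def dest: finite_elements)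

lemma insert_edge_matching:
  assumes "e \<subseteq> S" "card e = 2" "M \<in> matchings_on (S - e)"
  shows "insert e M \<in> matchings_on S" "e \<notin> M"
proof -
  have ne: "e \<noteq> {}" using assms(2) by auto
  have U: "\<Union>M = S - e" and D: "disjoint M" and N: "{} \<notin> M" and C: "\<forall>e\<in>M. card e = 2"
    using assms(3) by (auto simp: matchings_on_def partition_on_def)
  show "e \<notin> M" using U ne by blast
  have "disjoint (insert e M)"
    unfolding disjoint_def using U D by (auto simp: disjoint_def)
  then show "insert e M \<in> matchings_on S"
    using U N C ne assms(1,2) by (auto simp: matchings_on_def partition_on_def)
qed

lemma remove_edge_matching:
  assumes "M \<in> matchings_on S" "e \<in> M"
  shows "e \<subseteq> S" "card e = 2" "M - {e} \<in> matchings_on (S - e)"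
proof -
  have U: "\<Union>M = S" and D: "disjoint M" and N: "{} \<notin> M" and C: "\<forall>e\<in>M. card e = 2"
    using assms(1) by (auto simp: matchings_on_def partition_on_def)
  show "e \<subseteq> S" "card e = 2" using U C assms(2) by auto
  have "\<Union>(M - {e}) = S - e"
    using U D assms(2) by (fastforce simp: disjoint_def)
  moreover have "disjoint (M - {e})" using D by (auto simp: disjoint_def)
  ultimately show "M - {e} \<in> matchings_on (S - e)"
    using N C by (auto simp: matchings_on_def partition_on_def)
qed

text \<open>Double counting of matchings with a marked edge: choose the edge first, then match the
  remaining points. The predicate \<open>P\<close> later selects the edges through one point, or all
  edges.\<close>

lemma sum_matchings_edge:
  fixes f :: "'a set set \<Rightarrow> 'a set \<Rightarrow> 'b::comm_monoid_add"
  assumes "finite S"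
  shows "(\<Sum>M\<in>matchings_on S. \<Sum>e\<in>{e\<in>M. P e}. f M e) =
         (\<Sum>e\<in>{e. e \<subseteq> S \<and> card e = 2 \<and> P e}. \<Sum>M\<in>matchings_on (S - e). f (insert e M) e)"
proof -
  have fin: "finite {e. e \<subseteq> S \<and> card e = 2 \<and> P e}"
    using assms by (auto intro: finite_subset[of _ "Pow S"])
  have "(\<Sum>M\<in>matchings_on S. \<Sum>e\<in>{e\<in>M. P e}. f M e) =
        (\<Sum>(M, e)\<in>(SIGMA M:matchings_on S. {e\<in>M. P e}). f M e)"
    using assms by (intro sum.Sigma finite_matchings_on ballI finite_subset[OF _ finite_matching]) auto
  also have "\<dots> = (\<Sum>(e, M)\<in>(SIGMA e:{e. e \<subseteq> S \<and> card e = 2 \<and> P e}. matchings_on (S - e)).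
                    f (insert e M) e)"
    by (rule sum.reindex_bij_witness[where i = "\<lambda>(e, M). (insert e M, e)"
          and j = "\<lambda>(M, e). (e, M - {e})"])
       (use insert_edge_matching remove_edge_matching in \<open>fastforce simp: insert_absorb\<close>)+
  also have "\<dots> = (\<Sum>e\<in>{e. e \<subseteq> S \<and> card e = 2 \<and> P e}. \<Sum>M\<in>matchings_on (S - e). f (insert e M) e)"
    using assms fin by (intro sum.Sigma[symmetric]) (auto intro: finite_matchings_on)
  finally show ?thesis .
qed

text \<open>Exactly one edge passes through \<open>x\<close>, so marking it does not change the sum;
  that edge is then named by the partner \<open>w\<close> of \<open>x\<close>.\<close>

lemma sum_matchings_remove_point:
  fixes f :: "'a set set \<Rightarrow> 'b::comm_monoid_add"
  assumes "finite S" "x \<in> S"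
  shows "(\<Sum>M\<in>matchings_on S. f M) =
         (\<Sum>w\<in>S - {x}. \<Sum>M\<in>matchings_on (S - {x, w}). f (insert {x, w} M))"
proof -
  have "(\<Sum>M\<in>matchings_on S. f M) = (\<Sum>M\<in>matchings_on S. \<Sum>e\<in>{e\<in>M. x \<in> e}. f M)"
  proof (rule sum.cong[OF refl])
    fix M assume "M \<in> matchings_on S"
    then obtain e where "e \<in> M" "x \<in> e" and D: "disjoint M"
      using assms(2) by (auto simp: matchings_on_def partition_on_def)
    then have "{e\<in>M. x \<in> e} = {e}" by (auto simp: disjoint_def)
    then show "f M = (\<Sum>e\<in>{e\<in>M. x \<in> e}. f M)" by simp
  qed
  also have "\<dots> = (\<Sum>e\<in>{e. e \<subseteq> S \<and> card e = 2 \<and> x \<in> e}.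
                    \<Sum>M\<in>matchings_on (S - e). f (insert e M))"
    by (rule sum_matchings_edge) fact
  also have "{e. e \<subseteq> S \<and> card e = 2 \<and> x \<in> e} = (\<lambda>w. {x, w}) ` (S - {x})"
  proof (intro equalityI subsetI)
    fix e assume "e \<in> {e. e \<subseteq> S \<and> card e = 2 \<and> x \<in> e}"
    then show "e \<in> (\<lambda>w. {x, w}) ` (S - {x})"
      by (auto simp: card_2_iff)
  qed (use assms(2) in \<open>auto simp: card_2_iff\<close>)
  also have "(\<Sum>e\<in>\<dots>. \<Sum>M\<in>matchings_on (S - e). f (insert e M)) =
      (\<Sum>w\<in>S - {x}. \<Sum>M\<in>matchings_on (S - {x, w}). f (insert {x, w} M))"
    by (subst sum.reindex) (auto simp: inj_on_def doubleton_eq_iff)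
  finally show ?thesis .
qed

section \<open>The weighted count as a function of three cardinalities\<close>

lemma straddle_sum_remove_point:
  assumes "finite S" "x \<in> S"
  shows "straddle_sum y S L R =
    (\<Sum>w\<in>S - {x}. (if straddling L R {x, w} then y else 1) * straddle_sum y (S - {x, w}) L R)"
proof -
  have "y ^ card {f\<in>insert {x, w} M. straddling L R f} =
      (if straddling L R {x, w} then y else 1) * y ^ card {f\<in>M. straddling L R f}"
    if w: "w \<in> S - {x}" and M: "M \<in> matchings_on (S - {x, w})" for w M
  proof -
    have "{x, w} \<notin> M"
      using w assms by (intro insert_edge_matching(2)[OF _ _ M]) (auto simp: card_2_iff)
    moreover have "finite M" using M assms(1) by (auto intro: finite_matching)
    moreover have "{f\<in>insert {x, w} M. straddling L R f} =
      (if straddling L R {x, w} then insert {x, w} {f\<in>M. straddling L R f}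
       else {f\<in>M. straddling L R f})" by auto
    ultimately show ?thesis by simp
  qed
  then show ?thesis
    unfolding straddle_sum_def sum_matchings_remove_point[OF assms] sum_distrib_left
    by (intro sum.cong refl) auto
qed

text \<open>
  The arguments \<open>i\<close>, \<open>k\<close>, \<open>j\<close> are the numbers of points in \<open>L\<close>, in neither set, and in \<open>R\<close>.
  Truncation in \<open>i - 1\<close>, \<open>k - 1\<close>, \<open>j - 1\<close> is harmless, as the factor in front is then zero.
\<close>

function straddle_poly :: "'b::comm_semiring_1 \<Rightarrow> nat \<Rightarrow> nat \<Rightarrow> nat \<Rightarrow> 'b" where
  "straddle_poly y i (Suc k) j = of_nat i * straddle_poly y (i - 1) k j
     + of_nat k * straddle_poly y i (k - 1) j + of_nat j * straddle_poly y i k (j - 1)"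
| "straddle_poly y (Suc i) 0 j =
     of_nat i * straddle_poly y (i - 1) 0 j + y * of_nat j * straddle_poly y i 0 (j - 1)"
| "straddle_poly y 0 0 (Suc j) = of_nat j * straddle_poly y 0 0 (j - 1)"
| "straddle_poly y 0 0 0 = 1"
  by pat_completeness auto
termination by (relation "measure (\<lambda>(y, i, k, j). i + k + j)") auto

lemma card_Diff_doubleton:
  assumes "finite A" "x \<noteq> w"
  shows "card (A - {x, w}) =
    card A - (if x \<in> A then 1 else 0) - (if w \<in> A then 1 else 0)"
proof -
  have "A - {x, w} = A - {x} - {w}" by blast
  then show ?thesis using assms by (simp add: card_Diff_singleton_if)
qed

text \<open>Induction on \<open>S\<close>: the removed point is taken inside if possible, then left,
  then right, as in the equations of \<open>straddle_poly\<close>. All its partners within one class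
  leave the same three cardinalities and hence contribute equally.\<close>

lemma straddle_sum_eq_poly:
  fixes y :: "'b::comm_semiring_1"
  assumes "finite S" and disj: "L \<inter> R = {}"
  shows "straddle_sum y S L R =
    straddle_poly y (card (S \<inter> L)) (card (S - L - R)) (card (S \<inter> R))"
  using assms(1)
proof (induction S rule: finite_psubset_induct)
  case (psubset S)
  let ?p = "straddle_poly y" and ?W = "\<lambda>S. straddle_sum y S L R"
  let ?i = "card (S \<inter> L)" and ?k = "card (S - L - R)" and ?j = "card (S \<inter> R)"
  let ?g = "\<lambda>x w. (if straddling L R {x, w} then y else 1) * ?W (S - {x, w})"
  have fin: "finite (S \<inter> L)" "finite (S - L - R)" "finite (S \<inter> R)"
    using psubset.hyps by auto
  have IH: "?W (S - {x, w}) =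
      ?p (card (S \<inter> L - {x, w})) (card (S - L - R - {x, w})) (card (S \<inter> R - {x, w}))"
    if "x \<in> S" for x w
  proof -
    have "?W (S - {x, w}) = ?p (card ((S - {x, w}) \<inter> L)) (card (S - {x, w} - L - R))
        (card ((S - {x, w}) \<inter> R))"
      using that by (intro psubset.IH) blast
    moreover have "(S - {x, w}) \<inter> L = S \<inter> L - {x, w}" "S - {x, w} - L - R = S - L - R - {x, w}"
      "(S - {x, w}) \<inter> R = S \<inter> R - {x, w}" by blast+
    ultimately show ?thesis by simp
  qed
  have split: "?W S =
      sum (?g x) (S \<inter> L - {x}) + sum (?g x) (S - L - R - {x}) + sum (?g x) (S \<inter> R - {x})"
    if "x \<in> S" for x
  proof -
    have "?W S = sum (?g x) ((S \<inter> L - {x}) \<union> (S - L - R - {x}) \<union> (S \<inter> R - {x}))"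
      unfolding straddle_sum_remove_point[OF psubset.hyps that]
      by (rule arg_cong[where f = "sum _"]) blast
    also have "\<dots> = sum (?g x) ((S \<inter> L - {x}) \<union> (S - L - R - {x})) + sum (?g x) (S \<inter> R - {x})"
      using fin disj by (intro sum.union_disjoint) (simp, simp, blast)
    also have "sum (?g x) ((S \<inter> L - {x}) \<union> (S - L - R - {x})) =
        sum (?g x) (S \<inter> L - {x}) + sum (?g x) (S - L - R - {x})"
      using fin by (intro sum.union_disjoint) (simp, simp, blast)
    finally show ?thesis .
  qed
  \<comment> \<open>Here \<open>i\<close>, \<open>k\<close>, \<open>j\<close> are the class sizes
    left after \<open>x\<close> and any partner from \<open>A\<close> are gone, and \<open>c\<close>
    tells whether such an edge straddles.\<close>
  have const: "sum (?g x) A = of_nat (card A) * ((if c then y else 1) * ?p i k j)"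
    if "x \<in> S" "\<And>w. w \<in> A \<Longrightarrow> x \<noteq> w"
      and "\<And>w. w \<in> A \<Longrightarrow> straddling L R {x, w} = c"
      and "\<And>w. w \<in> A \<Longrightarrow> ?i - (if x \<in> S \<inter> L then 1 else 0) - (if w \<in> S \<inter> L then 1 else 0) = i"
      and "\<And>w. w \<in> A \<Longrightarrow> ?k - (if x \<in> S - L - R then 1 else 0) - (if w \<in> S - L - R then 1 else 0) = k"
      and "\<And>w. w \<in> A \<Longrightarrow> ?j - (if x \<in> S \<inter> R then 1 else 0) - (if w \<in> S \<inter> R then 1 else 0) = j"
    for x A c i k j
  proof -
    have "sum (?g x) A = (\<Sum>w\<in>A. (if c then y else 1) * ?p i k j)"
    proof (rule sum.cong[OF refl])
      fix w assume w: "w \<in> A"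
      show "?g x w = (if c then y else 1) * ?p i k j"
        unfolding IH[OF that(1)] that(3)[OF w] card_Diff_doubleton[OF fin(1) that(2)[OF w]]
          card_Diff_doubleton[OF fin(2) that(2)[OF w]] card_Diff_doubleton[OF fin(3) that(2)[OF w]]
          that(4)[OF w] that(5)[OF w] that(6)[OF w] ..
    qed
    then show ?thesis by simp
  qed
  consider x where "x \<in> S - L - R" | x where "S - L - R = {}" "x \<in> S \<inter> L"
    | x where "S - L - R = {}" "S \<inter> L = {}" "x \<in> S \<inter> R" | "S = {}" by blast
  then show ?case
  proof cases
    case 1
    then obtain k where k: "?k = Suc k" using fin by (cases ?k) auto
    have x: "x \<in> S" "x \<notin> L" "x \<notin> R" using 1 by auto
    \<comment> \<open>An edge at an inside point never straddles, so \<open>c\<close> is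
      \<open>False\<close> for all three classes.\<close>
    have "sum (?g x) (S \<inter> L - {x}) = of_nat (card (S \<inter> L - {x})) * ((if False then y else 1) * ?p (?i - 1) k ?j)"
      using disj k x by (intro const) (auto simp: straddling_def)
    moreover have "sum (?g x) (S - L - R - {x}) =
        of_nat (card (S - L - R - {x})) * ((if False then y else 1) * ?p ?i (k - 1) ?j)"
      using k x by (intro const) (auto simp: straddling_def)
    moreover have "sum (?g x) (S \<inter> R - {x}) =
        of_nat (card (S \<inter> R - {x})) * ((if False then y else 1) * ?p ?i k (?j - 1))"
      using disj k x by (intro const) (auto simp: straddling_def)
    moreover have "S \<inter> L - {x} = S \<inter> L" "S \<inter> R - {x} = S \<inter> R" "card (S - L - R - {x}) = k"
      using x k fin by (auto simp: card_Diff_singleton_if)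
    ultimately show ?thesis using split[OF x(1)] k by (simp add: mult_ac)
  next
    case 2
    then obtain i where i: "?i = Suc i" using fin by (cases ?i) auto
    have x: "x \<in> S" "x \<in> L" "x \<notin> R" using 2 disj by auto
    have k: "?k = 0" unfolding 2(1) by (rule card.empty)
    \<comment> \<open>With no inside points left, a left point yields the factor \<open>y\<close>
      exactly for its partners on the right.\<close>
    have "sum (?g x) (S \<inter> L - {x}) = of_nat (card (S \<inter> L - {x})) * ((if False then y else 1) * ?p (i - 1) 0 ?j)"
      using disj i x k by (intro const) (auto simp: straddling_def)
    moreover have "sum (?g x) (S \<inter> R - {x}) =
        of_nat (card (S \<inter> R - {x})) * ((if True then y else 1) * ?p i 0 (?j - 1))"
      using disj i x k by (intro const) (auto simp: straddling_def)
    moreover have "S \<inter> R - {x} = S \<inter> R" "card (S \<inter> L - {x}) = i"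
      using x i fin by (auto simp: card_Diff_singleton_if)
    ultimately show ?thesis using split[OF x(1)] i unfolding 2(1) by (simp add: mult_ac)
  next
    case 3
    then obtain j where j: "?j = Suc j" using fin by (cases ?j) auto
    have x: "x \<in> S" "x \<notin> L" "x \<in> R" using 3 by auto
    have ik: "?i = 0" "?k = 0" unfolding 3(1,2) by (rule card.empty)+
    have "sum (?g x) (S \<inter> R - {x}) =
        of_nat (card (S \<inter> R - {x})) * ((if False then y else 1) * ?p 0 0 (j - 1))"
      using disj j x ik by (intro const) (auto simp: straddling_def)
    moreover have "card (S \<inter> R - {x}) = j"
      using x j fin by (auto simp: card_Diff_singleton_if)
    ultimately show ?thesis using split[OF x(1)] j unfolding 3(1,2) by (simp add: mult_ac)
  next
    case 4
    have "matchings_on {} = {{} :: 'a set set}"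
      by (auto simp: matchings_on_def partition_on_def)
    then show ?thesis using 4 by (simp add: straddle_sum_def)
  qed
qed

text \<open>The recursion prefers left points and hides this symmetry; the weighted count shows it,
  because straddling is symmetric in \<open>L\<close> and \<open>R\<close>.\<close>

lemma straddle_poly_sym: "straddle_poly y i 0 j = straddle_poly y j 0 i"
proof -
  let ?S = "{..<i + j}" and ?L = "{..<i}" and ?R = "{i..<i + j}"
  have sets: "?S - ?L - ?R = {}" "?S - ?R - ?L = {}" "?S \<inter> ?L = ?L" "?S \<inter> ?R = ?R"
    and disj: "?L \<inter> ?R = {}" "?R \<inter> ?L = {}"
    by auto
  have "straddle_poly y i 0 j = straddle_sum y ?S ?L ?R"
    using straddle_sum_eq_poly[OF _ disj(1), of ?S y] unfolding sets by simp
  also have "\<dots> = straddle_sum y ?S ?R ?L"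
    by (simp add: straddle_sum_def straddling_def conj_commute)
  also have "\<dots> = straddle_poly y j 0 i"
    using straddle_sum_eq_poly[OF _ disj(2), of ?S y] unfolding sets by simp
  finally show ?thesis .
qed

section \<open>Recursions for the sums over all positions of the given pair\<close>

text \<open>The given pair occupies adjacent positions, with \<open>i\<close> points before it.
  \<open>N\<close> counts points, not pairs, so \<open>H\<^sub>n\<close> is
  \<open>adjacent_sum y (2 * n)\<close>.\<close>

definition adjacent_sum :: "'b::comm_semiring_1 \<Rightarrow> nat \<Rightarrow> 'b" where
  "adjacent_sum y N = (\<Sum>i\<le>N. straddle_poly y i 0 (N - i))"

text \<open>The symmetry \<open>i \<leftrightarrow> j\<close> replaces the factor \<open>i + 1\<close> by its mean \<open>(N + 2) / 2\<close>.\<close>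

lemma adjacent_sum_rec:
  fixes y :: "'b::field_char_0"
  shows "adjacent_sum y (Suc (Suc N)) =
    straddle_poly y 0 0 (Suc (Suc N)) + of_nat (N + 2) / 2 * (1 + y) * adjacent_sum y N"
proof -
  let ?p = "straddle_poly y"
  let ?f = "\<lambda>i. ?p i 0 (N - i)"
  have A: "(\<Sum>i\<le>Suc N. of_nat i * ?p (i - 1) 0 (Suc N - i)) = (\<Sum>i\<le>N. of_nat (i + 1) * ?f i)"
    by (subst sum.atMost_Suc_shift) simp
  have B: "(\<Sum>i\<le>Suc N. y * of_nat (Suc N - i) * ?p i 0 (Suc N - i - 1)) =
      y * (\<Sum>i\<le>N. of_nat (N - i + 1) * ?f i)"
  proof -
    have "(\<Sum>i\<le>Suc N. y * of_nat (Suc N - i) * ?p i 0 (Suc N - i - 1)) =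
        (\<Sum>i\<le>N. y * of_nat (Suc N - i) * ?p i 0 (Suc N - i - 1))"
      by simp
    also have "\<dots> = y * (\<Sum>i\<le>N. of_nat (N - i + 1) * ?f i)"
      unfolding sum_distrib_left
      by (intro sum.cong refl) (simp add: Suc_diff_le mult_ac del: of_nat_Suc of_nat_diff)
    finally show ?thesis .
  qed
  have rev: "(\<Sum>i\<le>N. of_nat (N - i + 1) * ?f i) = (\<Sum>i\<le>N. of_nat (i + 1) * ?f i)"
    by (rule sum.reindex_bij_witness[where i = "\<lambda>i. N - i" and j = "\<lambda>i. N - i"])
       (auto simp: straddle_poly_sym[of y "N - _"])
  have "(\<Sum>i\<le>N. of_nat (i + 1) * ?f i) + (\<Sum>i\<le>N. of_nat (N - i + 1) * ?f i) =
      (\<Sum>i\<le>N. of_nat (N + 2) * ?f i)"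
    unfolding sum.distrib[symmetric] distrib_right[symmetric] of_nat_add[symmetric]
    by (intro sum.cong refl) auto
  then have half: "(\<Sum>i\<le>N. of_nat (i + 1) * ?f i) = of_nat (N + 2) / 2 * adjacent_sum y N"
    unfolding rev adjacent_sum_def sum_distrib_left[symmetric] by (simp add: field_simps)
  \<comment> \<open>Only \<open>i = 0\<close> offers no left point to remove; its term is split off
    and stays unreduced.\<close>
  have "adjacent_sum y (Suc (Suc N)) =
      ?p 0 0 (Suc (Suc N)) + (\<Sum>i\<le>Suc N. ?p (Suc i) 0 (Suc N - i))"
    unfolding adjacent_sum_def by (subst sum.atMost_Suc_shift) simp
  also have "(\<Sum>i\<le>Suc N. ?p (Suc i) 0 (Suc N - i)) =
      (\<Sum>i\<le>Suc N. of_nat i * ?p (i - 1) 0 (Suc N - i)) +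
      (\<Sum>i\<le>Suc N. y * of_nat (Suc N - i) * ?p i 0 (Suc N - i - 1))"
    unfolding sum.distrib[symmetric] by (intro sum.cong refl straddle_poly.simps)
  also have "\<dots> = of_nat (N + 2) / 2 * (1 + y) * adjacent_sum y N"
    unfolding A B rev half by (simp only: distrib_left distrib_right mult_1 mult_1_right mult_ac)
  finally show ?thesis .
qed

definition triples :: "nat \<Rightarrow> (nat \<times> nat \<times> nat) set" where
  "triples N = {(i, k, j). i + k + j = N}"

text \<open>The gaps \<open>(i, k, j)\<close> fix the position of the given pair among
  \<open>N + 2\<close> points, so this is the weighted count over all positions and all matchings of
  the rest.\<close>

definition gap_sum :: "'b::comm_semiring_1 \<Rightarrow> nat \<Rightarrow> 'b" where
  "gap_sum y N = (\<Sum>(i, k, j)\<in>triples N. straddle_poly y i k j)"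

lemma finite_triples [simp]: "finite (triples N)"
  by (rule finite_subset[of _ "{..N} \<times> {..N} \<times> {..N}"]) (auto simp: triples_def)

lemma gap_sum_0: "gap_sum y 0 = 1"
proof -
  have "triples 0 = {(0, 0, 0)}" by (auto simp: triples_def)
  then show ?thesis by (simp add: gap_sum_def)
qed

text \<open>Triples with \<open>k = 0\<close> give the adjacent sum. In the others an inside point
  is removed together with its partner; a triple \<open>(i, k, j)\<close> of sum \<open>N\<close>
  then arises with the factors \<open>i + 1\<close>, \<open>k + 1\<close> and \<open>j + 1\<close>,
  which add up to \<open>N + 3\<close>.\<close>

lemma gap_sum_rec:
  fixes y :: "'b::comm_semiring_1"
  shows "gap_sum y (Suc (Suc N)) = of_nat (N + 3) * gap_sum y N + adjacent_sum y (Suc (Suc N))"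
proof -
  let ?p = "straddle_poly y"
  let ?Z = "{t\<in>triples (Suc (Suc N)). fst (snd t) = 0}"
  let ?P = "{t\<in>triples (Suc (Suc N)). fst (snd t) \<noteq> 0}"
  have Z: "(\<Sum>(i, k, j)\<in>?Z. ?p i k j) = adjacent_sum y (Suc (Suc N))"
    unfolding adjacent_sum_def
    by (rule sum.reindex_bij_witness[where j = fst and i = "\<lambda>i. (i, 0, Suc (Suc N) - i)"])
       (auto simp: triples_def intro!: arg_cong[where f = "?p a 0" for a])
  have "(\<Sum>(i, k, j)\<in>?P. ?p i k j) = (\<Sum>(i, k, j)\<in>triples (Suc N). ?p i (Suc k) j)"
    by (rule sum.reindex_bij_witness[where j = "\<lambda>(i, k, j). (i, k - 1, j)"
          and i = "\<lambda>(i, k, j). (i, Suc k, j)"]) (auto simp: triples_def gr0_conv_Suc)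
  also have "\<dots> = (\<Sum>(i, k, j)\<in>triples (Suc N). of_nat i * ?p (i - 1) k j)
      + (\<Sum>(i, k, j)\<in>triples (Suc N). of_nat k * ?p i (k - 1) j)
      + (\<Sum>(i, k, j)\<in>triples (Suc N). of_nat j * ?p i k (j - 1))"
    unfolding sum.distrib[symmetric] by (intro sum.cong refl) auto
  \<comment> \<open>Terms with \<open>i = 0\<close> have a zero factor, and dropping them makes
    \<open>i - 1\<close> a genuine predecessor to reindex by. The sums for \<open>k\<close> and
    \<open>j\<close> are treated alike.\<close>
  also have "(\<Sum>(i, k, j)\<in>triples (Suc N). of_nat i * ?p (i - 1) k j) =
      (\<Sum>(i, k, j)\<in>{t\<in>triples (Suc N). fst t \<noteq> 0}. of_nat i * ?p (i - 1) k j)"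
    by (rule sum.mono_neutral_right) (auto intro!: gr0I)
  also have "\<dots> = (\<Sum>(i, k, j)\<in>triples N. of_nat (i + 1) * ?p i k j)"
    by (rule sum.reindex_bij_witness[where j = "\<lambda>(i, k, j). (i - 1, k, j)" and i = "\<lambda>(i, k, j). (Suc i, k, j)"])
       (auto simp: triples_def gr0_conv_Suc simp del: of_nat_Suc)
  also have "(\<Sum>(i, k, j)\<in>triples (Suc N). of_nat k * ?p i (k - 1) j) =
      (\<Sum>(i, k, j)\<in>{t\<in>triples (Suc N). fst (snd t) \<noteq> 0}. of_nat k * ?p i (k - 1) j)"
    by (rule sum.mono_neutral_right) (auto intro!: gr0I)
  also have "\<dots> = (\<Sum>(i, k, j)\<in>triples N. of_nat (k + 1) * ?p i k j)"
    by (rule sum.reindex_bij_witness[where j = "\<lambda>(i, k, j). (i, k - 1, j)" and i = "\<lambda>(i, k, j). (i, Suc k, j)"])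
       (auto simp: triples_def gr0_conv_Suc simp del: of_nat_Suc)
  also have "(\<Sum>(i, k, j)\<in>triples (Suc N). of_nat j * ?p i k (j - 1)) =
      (\<Sum>(i, k, j)\<in>{t\<in>triples (Suc N). snd (snd t) \<noteq> 0}. of_nat j * ?p i k (j - 1))"
    by (rule sum.mono_neutral_right) (auto intro!: gr0I)
  also have "\<dots> = (\<Sum>(i, k, j)\<in>triples N. of_nat (j + 1) * ?p i k j)"
    by (rule sum.reindex_bij_witness[where j = "\<lambda>(i, k, j). (i, k, j - 1)" and i = "\<lambda>(i, k, j). (i, k, Suc j)"])
       (auto simp: triples_def gr0_conv_Suc simp del: of_nat_Suc)
  also have "(\<Sum>(i, k, j)\<in>triples N. of_nat (i + 1) * ?p i k j) +
      (\<Sum>(i, k, j)\<in>triples N. of_nat (k + 1) * ?p i k j) +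
      (\<Sum>(i, k, j)\<in>triples N. of_nat (j + 1) * ?p i k j) = of_nat (N + 3) * gap_sum y N"
  proof -
    have "of_nat (i + 1) * x + of_nat (k + 1) * x + of_nat (j + 1) * x = of_nat (N + 3) * x"
      if "i + k + j = N" for i k j and x :: 'b
      unfolding distrib_right[symmetric] of_nat_add[symmetric]
      by (rule arg_cong[where f = "\<lambda>m. of_nat m * x"]) (use that in simp)
    then show ?thesis
      unfolding gap_sum_def sum_distrib_left sum.distrib[symmetric]
      by (intro sum.cong refl) (auto simp: triples_def simp del: of_nat_add of_nat_Suc)
  qed
  finally have P: "(\<Sum>(i, k, j)\<in>?P. ?p i k j) = of_nat (N + 3) * gap_sum y N" .
  have "gap_sum y (Suc (Suc N)) = (\<Sum>(i, k, j)\<in>?P \<union> ?Z. ?p i k j)"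
    unfolding gap_sum_def by (rule sum.cong) auto
  also have "\<dots> = (\<Sum>(i, k, j)\<in>?P. ?p i k j) + (\<Sum>(i, k, j)\<in>?Z. ?p i k j)"
    by (rule sum.union_disjoint) auto
  finally show ?thesis unfolding P Z .
qed

section \<open>From configurations to gap sums\<close>

lemma configuration_weight_sum:
  fixes y :: "'b::comm_semiring_1"
  assumes "n \<ge> 1"
  shows "(\<Sum>p = 0..n - 1. of_nat (G n p) * y ^ p) =
    (\<Sum>(M, e)\<in>configurations n. y ^ card {f\<in>M - {e}. pair_contains f e})"
proof -
  let ?c = "\<lambda>(M, e). card {f\<in>M - {e}. pair_contains f e}"
  have conf: "configurations n = (SIGMA M:matchings_on {1..2 * n}. M)"
    by (auto simp: configurations_def perfect_matchings_def matchings_on_def)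
  have fin: "finite (configurations n)"
    unfolding conf by (intro finite_SigmaI finite_matchings_on) (auto intro: finite_matching)
  \<comment> \<open>The range of \<open>p\<close> must exhaust all values: counting points through
    edges shows that a matching has \<open>n\<close> edges, hence \<open>n - 1\<close> besides the
    given one.\<close>
  have le: "?c t \<in> {0..n - 1}" if "t \<in> configurations n" for t
  proof -
    obtain M e where "t = (M, e)" by (cases t)
    then have t: "t = (M, e)" "M \<in> matchings_on {1..2 * n}" "e \<in> M"
      using that unfolding conf by auto
    have fM: "finite M" using t by (auto intro: finite_matching)
    have "2 * n = card (\<Union>M)" using t by (auto simp: matchings_on_def partition_on_def)
    also have "\<dots> = (\<Sum>e\<in>M. card e)"
      using t by (intro card_Union_disjoint)
        (auto simp: matchings_on_def partition_on_def disjoint_def pairwise_def disjnt_def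
              intro: card_ge_0_finite)
    also have "\<dots> = 2 * card M" using t by (simp add: matchings_on_def)
    finally have "card M = n" by simp
    moreover have "card {f\<in>M - {e}. pair_contains f e} \<le> card (M - {e})"
      using fM by (intro card_mono) auto
    ultimately show ?thesis using t fM by simp
  qed
  have "(\<Sum>t\<in>configurations n. y ^ ?c t) =
      (\<Sum>p = 0..n - 1. \<Sum>t\<in>{t\<in>configurations n. ?c t = p}. y ^ ?c t)"
    using le by (intro sum.group[symmetric] fin) auto
  also have "\<dots> = (\<Sum>p = 0..n - 1. of_nat (G n p) * y ^ p)"
  proof (intro sum.cong refl)
    fix p
    have "(\<Sum>t\<in>{t\<in>configurations n. ?c t = p}. y ^ ?c t) =
        (\<Sum>t\<in>{t\<in>configurations n. ?c t = p}. y ^ p)"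
      by (rule sum.cong) auto
    also have "\<dots> = of_nat (card {t\<in>configurations n. ?c t = p}) * y ^ p"
      by (rule sum_constant)
    also have "card {t\<in>configurations n. ?c t = p} = G n p"
      unfolding G_def by (rule arg_cong[where f = card]) auto
    finally show "(\<Sum>t\<in>{t\<in>configurations n. ?c t = p}. y ^ ?c t) = of_nat (G n p) * y ^ p" .
  qed
  finally show ?thesis by (simp add: case_prod_unfold)
qed

text \<open>The order \<open>g < h\<close> determines which point of the pair is which, and a
  two-element set meeting both sides consists of just the two witnesses.\<close>

lemma pair_contains_iff_straddling:
  fixes g h :: nat
  assumes "g < h" "card f = 2"
  shows "pair_contains f {g, h} \<longleftrightarrow> straddling {..<g} {h<..} f"
proof
  assume "pair_contains f {g, h}"
  then obtain a b g' h' where f: "f = {a, b}" and "{g, h} = {g', h'}" "g' < h'"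
    and "a < g'" "h' < b"
    unfolding pair_contains_def by blast
  then have "a < g" "h < b" using assms(1) by (auto simp: doubleton_eq_iff)
  then show "straddling {..<g} {h<..} f" by (simp add: straddling_def f)
next
  assume "straddling {..<g} {h<..} f"
  then obtain a b where ab: "a \<in> f" "a < g" "b \<in> f" "h < b" by (auto simp: straddling_def)
  moreover obtain u v where "f = {u, v}" using assms(2) by (meson card_2_iff)
  ultimately have "f = {a, b}" using assms(1) by auto
  then show "pair_contains f {g, h}"
    unfolding pair_contains_def using ab assms(1) by (intro exI conjI) (assumption | rule refl)+
qed

text \<open>The given pair is chosen before the rest of the matching and recorded by its three gaps;
  the matchings of the remaining points are then counted by \<open>straddle_poly\<close>.\<close>

lemma G_weight_sum:
  fixes y :: "'b::comm_semiring_1"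
  assumes "n \<ge> 1"
  shows "(\<Sum>p = 0..n - 1. of_nat (G n p) * y ^ p) = gap_sum y (2 * n - 2)"
proof -
  let ?S = "{1..2 * n}"
  have conf: "configurations n = (SIGMA M:matchings_on ?S. {e\<in>M. True})"
    by (auto simp: configurations_def perfect_matchings_def matchings_on_def)
  have "(\<Sum>p = 0..n - 1. of_nat (G n p) * y ^ p) =
      (\<Sum>M\<in>matchings_on ?S. \<Sum>e\<in>{e\<in>M. True}. y ^ card {f\<in>M - {e}. pair_contains f e})"
    unfolding configuration_weight_sum[OF assms] conf
    by (intro sum.Sigma[symmetric] finite_matchings_on ballI) (auto intro: finite_matching)
  also have "\<dots> = (\<Sum>e\<in>{e. e \<subseteq> ?S \<and> card e = 2 \<and> True}. \<Sum>M\<in>matchings_on (?S - e).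
      y ^ card {f\<in>insert e M - {e}. pair_contains f e})"
    by (rule sum_matchings_edge) simp
  also have "\<dots> = (\<Sum>(i, k, j)\<in>triples (2 * n - 2). straddle_poly y i k j)"
  \<comment> \<open>With \<open>i\<close> points before it and \<open>k\<close> inside, the pair
    occupies positions \<open>i + 1\<close> and \<open>i + k + 2\<close>; conversely
    \<open>Min e\<close> and \<open>Max e\<close> determine the gaps, of total
    \<open>2 * n - 2\<close>.\<close>
  proof (rule sum.reindex_bij_witness[where i = "\<lambda>(i, k, j). {i + 1, i + k + 2}"
        and j = "\<lambda>e. (Min e - 1, Max e - Min e - 1, 2 * n - Max e)"], goal_cases)
    case (1 e)
    then obtain g h where "e = {g, h}" "g < h"
      by (auto simp: card_2_iff) (metis insert_commute linorder_neqE_nat)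
    with 1 show ?case by auto
  next
    case (2 e)
    then obtain g h where "e = {g, h}" "g < h"
      by (auto simp: card_2_iff) (metis insert_commute linorder_neqE_nat)
    with 2 show ?case by (auto simp: triples_def)
  next
    case (3 t)
    then show ?case using assms by (auto simp: triples_def)
  next
    case (4 t)
    then show ?case using assms by (auto simp: triples_def)
  next
    case (5 e)
    then obtain g h where e: "e = {g, h}" and gh: "g < h" "1 \<le> g" "h \<le> 2 * n"
      by (auto simp: card_2_iff) (metis insert_commute linorder_neqE_nat)
    have "(\<Sum>M\<in>matchings_on (?S - e). y ^ card {f\<in>insert e M - {e}. pair_contains f e}) =
        straddle_sum y (?S - e) {..<g} {h<..}"
      unfolding straddle_sum_def
    proof (intro sum.cong refl arg_cong[where f = "\<lambda>A. y ^ card A"])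
      fix M assume M: "M \<in> matchings_on (?S - e)"
      then have "e \<notin> M" using 5 by (intro insert_edge_matching(2)) auto
      then show "{f\<in>insert e M - {e}. pair_contains f e} = {f\<in>M. straddling {..<g} {h<..} f}"
        using M pair_contains_iff_straddling[OF gh(1)] by (auto simp: e matchings_on_def)
    qed
    also have "\<dots> = straddle_poly y (card ((?S - e) \<inter> {..<g})) (card (?S - e - {..<g} - {h<..}))
        (card ((?S - e) \<inter> {h<..}))"
      using gh by (intro straddle_sum_eq_poly) auto
    also have "\<dots> = straddle_poly y (g - 1) (h - g - 1) (2 * n - h)"
    proof -
      have "(?S - e) \<inter> {..<g} = {1..<g}" "?S - e - {..<g} - {h<..} = {g<..<h}"
          "(?S - e) \<inter> {h<..} = {h<..2 * n}"
        using gh by (auto simp: e)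
      then show ?thesis by simp
    qed
    finally show ?case using gh by (simp add: e)
  qed
  finally show ?thesis by (simp add: gap_sum_def)
qed

section \<open>Generating functions and their differential equation\<close>

lemma fps_deriv_fps_log:
  fixes F :: "'a::field_char_0 fps"
  assumes "F $ 0 = 1"
  shows "fps_deriv (fps_log F) = inverse F * fps_deriv F"
proof -
  have "inverse (1 + fps_X) oo (F - 1) = inverse ((1 + fps_X) oo (F - 1))"
    using assms by (intro fps_inverse_compose) auto
  also have "\<dots> = inverse F" using assms by (simp add: fps_compose_add_distrib)
  finally show ?thesis
    using assms by (simp add: fps_log_def fps_compose_deriv fps_ln_deriv)
qed

lemma fps_ode_operator_nth:
  fixes F :: "'a::field_char_0 fps"
  shows "((1 - 2 * fps_X) * fps_deriv F) $ n =
    of_nat (n + 1) * F $ (n + 1) - 2 * of_nat n * F $ n"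
  by (cases n) (simp_all add: algebra_simps numeral_fps_const)

text \<open>In an exponential generating function, differentiation shifts the numerators by one
  index.\<close>

lemma of_nat_Suc_mult_divide_fact:
  "of_nat (n + 1) * (a / fact (n + 1)) = (a / fact n :: 'a::field_char_0)"
  by (simp del: of_nat_Suc)

text \<open>Comparing coefficients gives a first-order recurrence whose leading factor
  \<open>n + 1\<close> is nonzero in characteristic 0, so the constant term determines the
  solution.\<close>

lemma fps_linear_ode_unique:
  fixes F H :: "'a::field_char_0 fps"
  assumes "(1 - 2 * fps_X) * fps_deriv F = F + Q" "(1 - 2 * fps_X) * fps_deriv H = H + Q"
    and "F $ 0 = H $ 0"
  shows "F = H"
proof -
  have nth: "of_nat (n + 1) * A $ (n + 1) = of_nat (2 * n + 1) * A $ n + Q $ n"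
    if "(1 - 2 * fps_X) * fps_deriv A = A + Q" for A n
    using arg_cong[OF that, of "\<lambda>f. f $ n"] unfolding fps_ode_operator_nth
    by (simp add: algebra_simps)
  have "F $ n = H $ n" for n
  proof (induction n)
    case (Suc n)
    have "of_nat (n + 1) * F $ (n + 1) = of_nat (n + 1) * H $ (n + 1)"
      unfolding nth[OF assms(1)] nth[OF assms(2)] Suc ..
    then show ?case by (simp del: of_nat_Suc)
  qed (rule assms(3))
  then show ?thesis by (rule fps_ext)
qed

text \<open>Differentiating the square of \<open>R\<close> gives
  \<open>R * fps_deriv R = - 1\<close>; the rule for the derivative of an inverse does the
  rest.\<close>

lemma inverse_fps_sqrt_ode:
  fixes R :: "'a::field_char_0 fps"
  defines "R \<equiv> fps_sqrt (1 - 2 * fps_X)"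
  shows "(1 - 2 * fps_X) * fps_deriv (inverse R) = inverse R"
proof -
  have R0: "R $ 0 \<noteq> 0" by (simp add: R_def fps_sqrt_nth_0)
  have sq: "R ^ 2 = 1 - 2 * fps_X" unfolding R_def by (rule fps_sqrt_power2) simp
  have "fps_deriv (R ^ 2) = - 2" unfolding sq by simp
  then have "2 * (R * fps_deriv R) = 2 * (- 1)" by (simp add: power2_eq_square algebra_simps)
  then have d: "R * fps_deriv R = - 1" by (simp only: mult_cancel_left) simp
  have inv: "inverse R * R = 1" using R0 by (rule inverse_mult_eq_1)
  have "fps_deriv (inverse R) = - fps_deriv R * (inverse R)\<^sup>2"
    using R0 by (rule fps_inverse_deriv)
  then have "(1 - 2 * fps_X) * fps_deriv (inverse R) = - (R * fps_deriv R) * (inverse R * R) * inverse R"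
    unfolding sq[symmetric] by (simp add: power2_eq_square mult_ac)
  then show ?thesis by (simp add: d inv)
qed

text \<open>The numbers \<open>straddle_poly y 0 0 (2 * n)\<close> are the double factorials (2n -
  1)!!. Their recurrence with factor \<open>2 * n + 1\<close> is the differential equation of the
  inverse square root, and both series start with 1.\<close>

lemma double_factorial_fps:
  "Abs_fps (\<lambda>n. straddle_poly y 0 0 (2 * n) / fact n) =
   inverse (fps_sqrt (1 - 2 * fps_X) :: 'a::field_char_0 fps)"
proof (rule fps_linear_ode_unique[where Q = 0])
  show "(1 - 2 * fps_X) * fps_deriv (Abs_fps (\<lambda>n. straddle_poly y 0 0 (2 * n) / fact n)) =
      Abs_fps (\<lambda>n. straddle_poly y 0 0 (2 * n) / fact n) + 0"
    unfolding fps_eq_iff fps_ode_operator_nth fps_add_nth fps_nth_Abs_fps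
      of_nat_Suc_mult_divide_fact
    by (simp add: add_divide_distrib algebra_simps)
qed (simp_all add: inverse_fps_sqrt_ode fps_sqrt_nth_0)

text \<open>Division by \<open>fact n\<close> absorbs the factor \<open>n\<close> in the recursion
  of \<open>adjacent_sum\<close> at even arguments, which leaves a geometric recursion with ratio
  \<open>1 + y\<close> and the double factorials as inhomogeneity.\<close>

lemma adjacent_fps:
  fixes y :: "'a::field_char_0"
  shows "Abs_fps (\<lambda>n. adjacent_sum y (2 * n) / fact n) * (1 - fps_const (1 + y) * fps_X) =
    inverse (fps_sqrt (1 - 2 * fps_X))"
  unfolding double_factorial_fps[of y, symmetric]
proof (rule fps_ext)
  fix n
  show "(Abs_fps (\<lambda>n. adjacent_sum y (2 * n) / fact n) * (1 - fps_const (1 + y) * fps_X)) $ n =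
      Abs_fps (\<lambda>n. straddle_poly y 0 0 (2 * n) / fact n) $ n"
  proof (cases n)
    case 0
    then show ?thesis by (simp add: adjacent_sum_def)
  next
    case (Suc m)
    have "adjacent_sum y (2 * Suc m) =
        straddle_poly y 0 0 (2 * Suc m) + of_nat (Suc m) * (1 + y) * adjacent_sum y (2 * m)"
    proof -
      have "of_nat (2 * m + 2) / 2 = (of_nat (Suc m) :: 'a)" by simp
      then show ?thesis using adjacent_sum_rec[of y "2 * m"]
        by (simp only: mult_Suc_right add_2_eq_Suc)
    qed
    moreover have "of_nat (Suc m) * (1 + y) * a / fact (Suc m) = a / fact m * (1 + y)" for a :: 'a
      by (simp del: of_nat_Suc)
    ultimately show ?thesis
      unfolding Suc by (simp add: add_divide_distrib right_diff_distrib mult.assoc[symmetric] del: fact_Suc of_nat_Suc mult_Suc_right)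
  qed
qed

text \<open>This is \<open>gap_sum_rec\<close> in terms of series: of the factor
  \<open>2 * n + 1\<close>, the part \<open>2 * n\<close> comes from the term
  \<open>2 * fps_X\<close> on the left and the 1 from \<open>F\<close> on the right.\<close>

lemma gap_fps_ode:
  fixes y :: "'a::field_char_0"
  defines "F \<equiv> Abs_fps (\<lambda>n. if n = 0 then 0 else gap_sum y (2 * n - 2) / fact n)"
  shows "(1 - 2 * fps_X) * fps_deriv F = F + Abs_fps (\<lambda>n. adjacent_sum y (2 * n) / fact n)"
proof (rule fps_ext)
  fix n
  have F: "of_nat (n + 1) * F $ (n + 1) = gap_sum y (2 * n) / fact n"
    unfolding F_def fps_nth_Abs_fps using of_nat_Suc_mult_divide_fact[of n "gap_sum y (2 * n)"] by simp
  show "((1 - 2 * fps_X) * fps_deriv F) $ n =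
      (F + Abs_fps (\<lambda>n. adjacent_sum y (2 * n) / fact n)) $ n"
  proof (cases n)
    case 0
    \<comment> \<open>\<open>gap_sum y 0\<close> and \<open>adjacent_sum y 0\<close> are both 1,
      which fits the constant term 0 of \<open>F\<close>.\<close>
    then show ?thesis unfolding fps_ode_operator_nth F by (simp add: F_def gap_sum_0 adjacent_sum_def)
  next
    case (Suc m)
    have "gap_sum y (2 * n) = of_nat (2 * n + 1) * gap_sum y (2 * n - 2) + adjacent_sum y (2 * n)"
      using gap_sum_rec[of y "2 * m"] by (simp add: Suc numeral_3_eq_3)
    then show ?thesis unfolding fps_ode_operator_nth F
      using Suc by (simp add: F_def add_divide_distrib algebra_simps)
  qed
qed

section \<open>The closed form\<close>

text \<open>Product rule: \<open>D * fps_deriv T = T\<close> reproduces \<open>H\<close>, while the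
  derivative of the logarithm contributes \<open>1 - y\<close> over \<open>E\<close>, whose
  numerator cancels the prefactor.\<close>

lemma closed_form_ode:
  fixes y :: "'a::field_char_0"
  assumes "y \<noteq> 1"
  defines "D \<equiv> 1 - 2 * fps_X" and "E \<equiv> 1 - fps_X * fps_const (1 + y)"
  defines "H \<equiv> 1 / (fps_const (1 - y) * fps_sqrt D) * fps_log (E / D)"
  shows "D * fps_deriv H = H + inverse (fps_sqrt D) * inverse E"
proof -
  define T where "T = inverse (fps_sqrt D)"
  define l where "l = fps_log (E / D)"
  define c where "c = fps_const (inverse (1 - y))"
  have D0: "D $ 0 = 1" and E0: "E $ 0 = 1" by (simp_all add: D_def E_def)
  have iD: "inverse D * D = 1" and iE: "inverse E * E = 1"
    using D0 E0 by (auto intro!: inverse_mult_eq_1)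
  have ED: "E / D = E * inverse D" using D0 by (intro fps_divide_unit) simp
  have H: "H = c * T * l"
    using assms(1) unfolding H_def l_def c_def T_def
    by (subst fps_divide_unit) (simp_all add: fps_sqrt_nth_0 fps_inverse_mult fps_const_inverse)
  have T: "D * fps_deriv T = T"
    unfolding T_def D_def by (rule inverse_fps_sqrt_ode)
  have inv: "inverse (E * inverse D) = inverse E * D"
    using D0 by (simp add: fps_inverse_mult)
  have dED: "fps_deriv (E * inverse D) = fps_deriv E * inverse D - E * fps_deriv D * (inverse D)\<^sup>2"
    using D0 by (simp add: fps_inverse_deriv)
  have dE: "fps_deriv E = - fps_const (1 + y)" and dD: "fps_deriv D = - 2"
    by (simp_all add: E_def D_def)
  have "D * fps_deriv l = D * (inverse E * D) * fps_deriv (E * inverse D)"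
    using D0 E0 unfolding l_def ED by (subst fps_deriv_fps_log) (simp_all add: inv mult_ac)
  also have "\<dots> = inverse E * (fps_deriv E * D * (inverse D * D) - E * fps_deriv D * (inverse D * D)\<^sup>2)"
    unfolding dED by (simp add: algebra_simps power2_eq_square)
  \<comment> \<open>The terms in z cancel: -(1 + y)(1 - 2z) + 2(1 - (1 + y)z) = 1 - y.\<close>
  also have "fps_deriv E * D * (inverse D * D) - E * fps_deriv D * (inverse D * D)\<^sup>2 = fps_const (1 - y)"
    unfolding iD dE dD unfolding D_def E_def
    by (simp add: algebra_simps numeral_fps_const flip: fps_const_add fps_const_sub)
  finally have l: "D * fps_deriv l = inverse E * fps_const (1 - y)" .
  have c: "c * fps_const (1 - y) = 1" using assms(1) by (simp add: c_def)
  have "D * fps_deriv H = c * (D * fps_deriv T) * l + c * T * (D * fps_deriv l)"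
    unfolding H by (simp add: c_def algebra_simps)
  also have "\<dots> = H + T * inverse E * (c * fps_const (1 - y))"
    unfolding T l by (simp add: H mult_ac)
  finally show ?thesis unfolding c T_def by simp
qed

theorem theorem18:
  shows "Abs_fps (\<lambda>n. if n = 0 then 0
             else (\<Sum>p = 0..n - 1. of_nat (G n p) * yvar ^ p * (1 / fact n)))
         = 1 / (fps_const (1 - yvar) * fps_sqrt (1 - 2 * zvar))
             * fps_log ((1 - zvar * fps_const (1 + yvar)) / (1 - 2 * zvar))"
proof -
  let ?E = "1 - zvar * fps_const (1 + yvar)"
  let ?Q = "Abs_fps (\<lambda>n. adjacent_sum yvar (2 * n) / fact n)"
  \<comment> \<open>The indeterminate is not the constant 1, so \<open>1 - yvar\<close> is
    invertible in the field of rational functions.\<close>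
  have y1: "yvar \<noteq> 1"
  proof -
    have "to_fract [:0, 1:] \<noteq> to_fract (1 :: rat poly)"
      unfolding to_fract_eq_iff by (simp add: one_pCons)
    then show ?thesis unfolding to_fract_1 .
  qed
  \<comment> \<open>Dividing by \<open>?E\<close> identifies the inhomogeneous term of the closed
    form with \<open>?Q\<close>.\<close>
  have QE: "?Q * ?E = inverse (fps_sqrt (1 - 2 * zvar))"
    using adjacent_fps[of yvar] unfolding mult.commute[of zvar] .
  have "inverse (fps_sqrt (1 - 2 * zvar)) * inverse ?E = ?Q * (inverse ?E * ?E)"
    unfolding QE[symmetric] by (simp only: mult_ac)
  also have "inverse ?E * ?E = 1" by (rule inverse_mult_eq_1) simp
  finally have Q: "inverse (fps_sqrt (1 - 2 * zvar)) * inverse ?E = ?Q" by simp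
  have coeffs: "(if n = 0 then 0 else (\<Sum>p = 0..n - 1. of_nat (G n p) * yvar ^ p * (1 / fact n))) =
      (if n = 0 then 0 else gap_sum yvar (2 * n - 2) / fact n)" for n
  proof (cases "n = 0")
    case False
    have "(\<Sum>p = 0..n - 1. of_nat (G n p) * yvar ^ p * (1 / fact n)) =
        (\<Sum>p = 0..n - 1. of_nat (G n p) * yvar ^ p) * (1 / fact n)"
      by (rule sum_distrib_right[symmetric])
    also have "(\<Sum>p = 0..n - 1. of_nat (G n p) * yvar ^ p) = gap_sum yvar (2 * n - 2)"
      using False by (intro G_weight_sum) simp
    finally show ?thesis using False by simp
  qed simp
  show ?thesis unfolding coeffs
  proof (rule fps_linear_ode_unique[where Q = ?Q])
    show "(1 - 2 * zvar) * fps_deriv (Abs_fps (\<lambda>n. if n = 0 then 0 else gap_sum yvar (2 * n - 2) / fact n)) =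
        Abs_fps (\<lambda>n. if n = 0 then 0 else gap_sum yvar (2 * n - 2) / fact n) + ?Q"
      by (rule gap_fps_ode)
    show "(1 - 2 * zvar) * fps_deriv (1 / (fps_const (1 - yvar) * fps_sqrt (1 - 2 * zvar))
             * fps_log (?E / (1 - 2 * zvar))) =
        1 / (fps_const (1 - yvar) * fps_sqrt (1 - 2 * zvar)) * fps_log (?E / (1 - 2 * zvar)) + ?Q"
      using closed_form_ode[OF y1] unfolding Q .
  \<comment> \<open>Both constant terms vanish, on the right because the logarithm has constant term
    0.\<close>
  qed (simp add: fps_log_def fps_ln_def)
qed

end
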